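(* Let $d\ge 3$ be an integer, $e\in K$ a primitive $d$-th root of $1$, and let $a,b,c$ be integers with $0\le a\le b\le c\le d-1$ and $\gcd(a,b,c,d)=1$. Let $M_{a,b,c}=\begin{pmatrix}e^a&0&0\\0&e^b&0\\0&0&e^c\end{pmatrix}$. The ideal $I\subset K[x,y,z]$ generated by all forms of degree $d$ invariant under the action of $M_{a,b,c}$ is a monomial ideal. In particular, any GT-system is monomial.
   Context: $K$ is an algebraically closed field of characteristic zero and $R=K[x,y,z]$. The matrix $M_{a,b,c}$ acts on $R$ by $x\mapsto e^a x$, $y\mapsto e^b y$, $z\mapsto e^c z$; a form is invariant if it is fixed by this action. $\mu(I)$ is the minimal number of generators of $I$. A homogeneous artinian ideal $I\subset R$ generated by forms of degree $d$ with $\mu(I)\le d+1$ is a Togliatti system if for every linear form $L$ the multiplication map $\times L:(R/I)_{d-1}\to (R/I)_d$ does not have maximal rank. A GT-system is a Togliatti system generated by forms of degree $d$, namely by all forms of degree $d$ invariant under some $M_{a,b,c}$ as in the claim, whose associated morphism $\varphi_I:\mathbb{P}^2\to\mathbb{P}^{\mu(I)-1}$ is a Galois covering of its image with cyclic Galois group $\mathbb{Z}/d\mathbb{Z}$. *)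

theory Defs
  imports
    "HOL-Analysis.Analysis"
    "HOL-Library.Poly_Mapping"
    "HOL-Library.Set_Algebras"
    "HOL-Computational_Algebra.Computational_Algebra"
    "HOL-Algebra.Bij"
    "HOL-Algebra.Elementary_Groups"
begin

no_notation fps_nth (infixl \<open>$\<close> 75)

section \<open>The polynomial ring in three variables\<close>

text \<open>
  \<open>R = K[x,y,z]\<close> is the monoid algebra of the exponent vectors \<open>3 \<Rightarrow>\<^sub>0 nat\<close>. As for
  \<open>'k ^ 3\<close>, the indices are \<open>1, 2, 3 :: 3\<close>, so that \<open>x\<close>, \<open>y\<close>, \<open>z\<close> are \<open>var 1\<close>, \<open>var 2\<close>, \<open>var 3\<close>.
\<close>

type_synonym 'k poly3 = "(3 \<Rightarrow>\<^sub>0 nat) \<Rightarrow>\<^sub>0 'k"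

definition cst :: "'k::zero \<Rightarrow> 'k poly3" where
  "cst c = Poly_Mapping.single 0 c"

definition monomial :: "(3 \<Rightarrow>\<^sub>0 nat) \<Rightarrow> 'k::zero_neq_one poly3" where
  "monomial m = Poly_Mapping.single m 1"

definition var :: "3 \<Rightarrow> 'k::zero_neq_one poly3" where
  "var i = monomial (Poly_Mapping.single i 1)"

definition form :: "nat \<Rightarrow> 'k::zero poly3 \<Rightarrow> bool" where
  "form n f \<longleftrightarrow> (\<forall>m\<in>Poly_Mapping.keys f. (\<Sum>i\<in>UNIV. Poly_Mapping.lookup m i) = n)"

definition evalp :: "'k::comm_semiring_1 poly3 \<Rightarrow> (3 \<Rightarrow> 'k) \<Rightarrow> 'k" where
  "evalp f p = (\<Sum>m\<in>Poly_Mapping.keys f.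
     Poly_Mapping.lookup f m * (\<Prod>i\<in>UNIV. p i ^ Poly_Mapping.lookup m i))"

text \<open>A matrix \<open>A\<close> acts on \<open>R\<close> by the \<open>K\<close>-algebra map sending the \<open>i\<close>-th variable to
  \<open>\<Sum>j. A\<^sub>i\<^sub>j x\<^sub>j\<close>.\<close>

definition mat_act :: "'k::comm_semiring_1 ^ 3 ^ 3 \<Rightarrow> 'k poly3 \<Rightarrow> 'k poly3" where
  "mat_act A f = (\<Sum>m\<in>Poly_Mapping.keys f. cst (Poly_Mapping.lookup f m) *
     (\<Prod>i\<in>UNIV. (\<Sum>j\<in>UNIV. cst (A $ i $ j) * var j) ^ Poly_Mapping.lookup m i))"

definition diag_mat :: "'k::comm_semiring_1 \<Rightarrow> nat \<Rightarrow> nat \<Rightarrow> nat \<Rightarrow> 'k ^ 3 ^ 3" where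
  "diag_mat e a b c = vector [vector [e ^ a, 0, 0], vector [0, e ^ b, 0], vector [0, 0, e ^ c]]"

definition primitive_root :: "nat \<Rightarrow> 'k::monoid_mult \<Rightarrow> bool" where
  "primitive_root d e \<longleftrightarrow> e ^ d = 1 \<and> (\<forall>k. 0 < k \<and> k < d \<longrightarrow> e ^ k \<noteq> 1)"


section \<open>Ideals\<close>

text \<open>The ideals of \<open>R\<close> are the submodules of \<open>R\<close> as a module over itself.\<close>

abbreviation is_ideal :: "'k::comm_ring_1 poly3 set \<Rightarrow> bool" where
  "is_ideal \<equiv> module.subspace (*)"

abbreviation ideal_gen :: "'k::comm_ring_1 poly3 set \<Rightarrow> 'k poly3 set" where
  "ideal_gen \<equiv> module.span (*)"

definition monomial_ideal :: "'k::comm_ring_1 poly3 set \<Rightarrow> bool" where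
  "monomial_ideal I \<longleftrightarrow> (\<exists>S. I = ideal_gen (monomial ` S))"

definition invariant_ideal :: "nat \<Rightarrow> 'k::comm_ring_1 ^ 3 ^ 3 \<Rightarrow> 'k poly3 set" where
  "invariant_ideal d A = ideal_gen {f. form d f \<and> mat_act A f = f}"

definition mu :: "'k::comm_ring_1 poly3 set \<Rightarrow> nat" where
  "mu I = (LEAST n. \<exists>G. finite G \<and> card G = n \<and> ideal_gen G = I)"

text \<open>\<open>R/I\<close> is an artinian ring; the ideals of \<open>R/I\<close> correspond to the ideals of \<open>R\<close> containing \<open>I\<close>.\<close>

definition artinian_ideal :: "'k::comm_ring_1 poly3 set \<Rightarrow> bool" where
  "artinian_ideal I \<longleftrightarrow> is_ideal I \<and>
     (\<forall>J :: nat \<Rightarrow> 'k poly3 set. (\<forall>n. is_ideal (J n) \<and> I \<subseteq> J n \<and> J (Suc n) \<subseteq> J n) \<longrightarrow>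
        (\<exists>N. \<forall>n\<ge>N. J n = J N))"


section \<open>Togliatti systems\<close>

definition quot_piece :: "'k::comm_ring_1 poly3 set \<Rightarrow> nat \<Rightarrow> 'k poly3 set set" where
  "quot_piece I n = {f +o I | f. form n f}"

text \<open>On cosets: \<open>L (f + I) + I = L f + I\<close>.\<close>

definition quot_mult :: "'k::comm_ring_1 poly3 set \<Rightarrow> 'k poly3 \<Rightarrow> 'k poly3 set \<Rightarrow> 'k poly3 set" where
  "quot_mult I L C = (L *o C) + I"

text \<open>A linear map of finite-dimensional spaces has maximal rank if it is injective or surjective.\<close>

definition maximal_rank :: "'k::comm_ring_1 poly3 set \<Rightarrow> 'k poly3 \<Rightarrow> nat \<Rightarrow> bool" where
  "maximal_rank I L d \<longleftrightarrow> inj_on (quot_mult I L) (quot_piece I (d - 1)) \<or>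
     quot_mult I L ` quot_piece I (d - 1) = quot_piece I d"

definition togliatti_system :: "nat \<Rightarrow> 'k::comm_ring_1 poly3 set \<Rightarrow> bool" where
  "togliatti_system d I \<longleftrightarrow>
     (\<exists>G. (\<forall>g\<in>G. form d g) \<and> I = ideal_gen G) \<and> artinian_ideal I \<and> mu I \<le> d + 1 \<and>
     (\<forall>L. form 1 L \<longrightarrow> \<not> maximal_rank I L d)"


section \<open>Projective space and Galois coverings\<close>

text \<open>The point with homogeneous coordinates \<open>v \<noteq> 0\<close> is the set of all its coordinate vectors.\<close>

definition proj_pt :: "('i \<Rightarrow> 'k::field) \<Rightarrow> ('i \<Rightarrow> 'k) set" where
  "proj_pt v = {\<lambda>i. t * v i | t. t \<noteq> 0}"

definition P2 :: "(3 \<Rightarrow> 'k::field) set set" where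
  "P2 = proj_pt ` {v. v \<noteq> (\<lambda>_. 0)}"

text \<open>A map from the plane to itself is a morphism if every point has a Zariski neighbourhood
  (the complement of a curve \<open>G = 0\<close>) on which it is given by forms of the same degree
  without common zeros.\<close>

definition regular_map :: "((3 \<Rightarrow> 'k::field) set \<Rightarrow> (3 \<Rightarrow> 'k) set) \<Rightarrow> bool" where
  "regular_map \<sigma> \<longleftrightarrow> (\<forall>P\<in>P2. \<exists>m n (G :: 'k poly3) (F :: 3 \<Rightarrow> 'k poly3).
     form m G \<and> (\<forall>i. form n (F i)) \<and> (\<forall>p\<in>P. evalp G p \<noteq> 0) \<and>
     (\<forall>q. q \<noteq> (\<lambda>_. 0) \<and> evalp G q \<noteq> 0 \<longrightarrow>
        (\<lambda>i. evalp (F i) q) \<noteq> (\<lambda>_. 0) \<and> \<sigma> (proj_pt q) = proj_pt (\<lambda>i. evalp (F i) q)))"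

text \<open>The deck transformations of \<open>\<phi>\<close>: the automorphisms \<open>\<sigma>\<close> of the variety \<open>P2\<close>
  such that \<open>\<phi> \<circ> \<sigma> = \<phi>\<close>.\<close>

definition deck_group ::
  "((3 \<Rightarrow> 'k::field) set \<Rightarrow> 'y) \<Rightarrow> ((3 \<Rightarrow> 'k) set \<Rightarrow> (3 \<Rightarrow> 'k) set) monoid" where
  "deck_group \<phi> = (BijGroup P2)\<lparr>carrier := {\<sigma> \<in> Bij P2. regular_map \<sigma> \<and>
     regular_map (inv_into P2 \<sigma>) \<and> (\<forall>P\<in>P2. \<phi> (\<sigma> P) = \<phi> P)}\<rparr>"

text \<open>A finite morphism is a Galois covering of its image if its deck group is transitive on the
  fibres, and then the deck group is its Galois group. Finiteness of \<open>\<phi>\<close> is not a separate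
  condition: a finite transitive deck group makes the fibres finite, and a morphism from the
  projective plane with finite fibres is finite.\<close>

definition cyclic_galois_covering :: "nat \<Rightarrow> ((3 \<Rightarrow> 'k::field) set \<Rightarrow> 'y) \<Rightarrow> bool" where
  "cyclic_galois_covering d \<phi> \<longleftrightarrow>
     (\<forall>P\<in>P2. \<forall>Q\<in>P2. \<phi> P = \<phi> Q \<longrightarrow> (\<exists>\<sigma>\<in>carrier (deck_group \<phi>). \<sigma> P = Q)) \<and>
     deck_group \<phi> \<cong> integer_mod_group d"


section \<open>GT-systems\<close>

text \<open>The morphism with components \<open>F\<^sub>0, \<dots>, F\<^bsub>r-1\<^esub>\<close>. Points of projective
  \<open>(r-1)\<close>-space are given by coordinate sequences vanishing from index \<open>r\<close> on. The value does not depend on the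
  representative \<open>p\<close> since all \<open>F\<^sub>i\<close> are forms of the same degree.\<close>

definition morphism_of :: "'k::field poly3 list \<Rightarrow> (3 \<Rightarrow> 'k) set \<Rightarrow> (nat \<Rightarrow> 'k) set" where
  "morphism_of Fs P = (let p = (SOME p. p \<in> P) in
     proj_pt (\<lambda>i. if i < length Fs then evalp (Fs ! i) p else 0))"

text \<open>\<open>\<phi>\<^sub>I\<close> is \<open>morphism_of Fs\<close> for a minimal system \<open>Fs\<close> of generators of \<open>I\<close> of degree \<open>d\<close>; another
  choice changes it by a linear change of coordinates of the target, which affects
  neither the fibres nor the deck group.\<close>

definition GT_system :: "nat \<Rightarrow> 'k::field poly3 set \<Rightarrow> bool" where
  "GT_system d I \<longleftrightarrow> togliatti_system d I \<and>
     (\<exists>e a b c. primitive_root d e \<and> a \<le> b \<and> b \<le> c \<and> c \<le> d - 1 \<and> Gcd {a, b, c, d} = 1 \<and>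
        I = invariant_ideal d (diag_mat e a b c)) \<and>
     (\<exists>Fs. (\<forall>f\<in>set Fs. form d f) \<and> length Fs = mu I \<and> ideal_gen (set Fs) = I \<and>
        cyclic_galois_covering d (morphism_of Fs))"

end

theory Submission
  imports Defs
begin

text \<open>
  A diagonal matrix multiplies every monomial by a scalar, so, \<open>K\<close> having no zero divisors, a form
  is fixed if and only if each monomial that occurs in it is fixed. Hence the invariant forms of
  degree \<open>d\<close> lie in the span of the invariant monomials of degree \<open>d\<close>.
\<close>

lemma prod_single:
  "(\<Prod>i\<in>A. Poly_Mapping.single (g i) (h i)) = Poly_Mapping.single (\<Sum>i\<in>A. g i) (\<Prod>i\<in>A. h i)"
  by (induction A rule: infinite_finite_induct) (simp_all add: mult_single single_one)

lemma sum_single_lookup: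
  fixes m :: "'i::finite \<Rightarrow>\<^sub>0 'b::comm_monoid_add"
  shows "(\<Sum>i\<in>UNIV. Poly_Mapping.single i (Poly_Mapping.lookup m i)) = m"
  by (rule poly_mapping_eqI) (simp add: lookup_sum lookup_single when_def)

lemma single_var_power:
  "Poly_Mapping.single (Poly_Mapping.single i (1::nat)) c ^ n
     = Poly_Mapping.single (Poly_Mapping.single i n) (c ^ n)"
  by (induction n) (simp_all add: mult_single single_one flip: single_add)

lemma cst_mult_var: "cst c * var i = Poly_Mapping.single (Poly_Mapping.single i 1) (c::'k::comm_semiring_1)"
  by (simp add: cst_def var_def monomial_def mult_single)

text \<open>Each variable goes to a scalar multiple of itself, so the image of a power product is
  again one \<open>single\<close>, whose exponents add up to \<open>m\<close>.\<close>

lemma mat_act_diagonal: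
  fixes A :: "'k::comm_semiring_1 ^ 3 ^ 3"
  assumes "\<And>i j. i \<noteq> j \<Longrightarrow> A $ i $ j = 0"
  shows "mat_act A f = (\<Sum>m\<in>Poly_Mapping.keys f. Poly_Mapping.single m
           (Poly_Mapping.lookup f m * (\<Prod>i\<in>UNIV. A $ i $ i ^ Poly_Mapping.lookup m i)))"
proof -
  have row: "(\<Sum>j\<in>UNIV. cst (A $ i $ j) * var j) = Poly_Mapping.single (Poly_Mapping.single i 1) (A $ i $ i)" for i
  proof -
    have "(\<Sum>j\<in>UNIV. cst (A $ i $ j) * var j) = (\<Sum>j\<in>UNIV. if j = i then cst (A $ i $ i) * var i else 0)"
      using assms by (intro sum.cong) (auto simp: cst_def)
    then show ?thesis by (simp add: cst_mult_var)
  qed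
  show ?thesis
    unfolding mat_act_def row single_var_power prod_single sum_single_lookup
    by (simp add: cst_def mult_single)
qed

text \<open>No two monomials have images that mix, so coefficients can be read off one by one;
  outside \<open>keys f\<close> both sides are 0.\<close>

lemma lookup_mat_act_diagonal:
  fixes A :: "'k::comm_semiring_1 ^ 3 ^ 3"
  assumes "\<And>i j. i \<noteq> j \<Longrightarrow> A $ i $ j = 0"
  shows "Poly_Mapping.lookup (mat_act A f) m
           = Poly_Mapping.lookup f m * (\<Prod>i\<in>UNIV. A $ i $ i ^ Poly_Mapping.lookup m i)"
  by (simp add: mat_act_diagonal[OF assms] lookup_sum lookup_single when_def in_keys_iff)

text \<open>Compare coefficients: in a domain a nonzero \<open>c\<close> satisfies
  \<open>c * w = c\<close> only for \<open>w = 1\<close>.\<close>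

lemma mat_act_diagonal_fixed_iff:
  fixes A :: "'k::idom ^ 3 ^ 3"
  assumes "\<And>i j. i \<noteq> j \<Longrightarrow> A $ i $ j = 0"
  shows "mat_act A f = f \<longleftrightarrow>
           (\<forall>m\<in>Poly_Mapping.keys f. (\<Prod>i\<in>UNIV. A $ i $ i ^ Poly_Mapping.lookup m i) = 1)"
  by (auto simp: poly_mapping_eq_iff fun_eq_iff lookup_mat_act_diagonal[OF assms] in_keys_iff)

lemma keys_monomial: "Poly_Mapping.keys (monomial m :: 'k::zero_neq_one poly3) = {m}"
  by (simp add: monomial_def)

lemma sum_cst_mult_monomial:
  fixes f :: "'k::comm_semiring_1 poly3"
  shows "(\<Sum>m\<in>Poly_Mapping.keys f. cst (Poly_Mapping.lookup f m) * monomial m) = f"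
  by (rule poly_mapping_eqI)
     (simp add: cst_def monomial_def mult_single lookup_sum lookup_single when_def in_keys_iff)

lemma module_mult: "module ((*) :: 'a::comm_ring_1 \<Rightarrow> 'a \<Rightarrow> 'a)"
  by unfold_locales (simp_all add: algebra_simps)

text \<open>Every \<open>f\<close> is a combination of the monomials in its support, and these are
  themselves among the generators.\<close>

lemma monomial_ideal_ideal_gen:
  fixes F :: "'k::comm_ring_1 poly3 set"
  assumes "\<And>f m. f \<in> F \<Longrightarrow> m \<in> Poly_Mapping.keys f \<Longrightarrow> monomial m \<in> F"
  shows "monomial_ideal (ideal_gen F)"
proof -
  interpret module "(*) :: 'k poly3 \<Rightarrow> 'k poly3 \<Rightarrow> 'k poly3" by (rule module_mult)
  \<comment> \<open>Taking only monomials that already lie in \<open>F\<close> makes the inclusion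
    into \<open>span F\<close> immediate.\<close>
  define S :: "(3 \<Rightarrow>\<^sub>0 nat) set" where "S = {m. (monomial m :: 'k poly3) \<in> F}"
  have "F \<subseteq> span (monomial ` S)"
  proof
    fix f assume "f \<in> F"
    \<comment> \<open>The scalars of this module are polynomials, so the coefficients enter as
      constants \<open>cst\<close>.\<close>
    then have "(\<Sum>m\<in>Poly_Mapping.keys f. cst (Poly_Mapping.lookup f m) * monomial m) \<in> span (monomial ` S)"
      using assms by (intro span_sum span_scale span_base imageI) (simp add: S_def)
    then show "f \<in> span (monomial ` S)" by (simp only: sum_cst_mult_monomial)
  qed
  moreover have "monomial ` S \<subseteq> span F" by (auto simp: S_def intro: span_base)
  ultimately have "span F = span (monomial ` S)" by (simp add: span_eq)
  then show ?thesis unfolding monomial_ideal_def by blast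
qed

text \<open>Having degree \<open>d\<close> and being fixed are both tested on each exponent of the
  support separately, so they pass from a form to its monomials.\<close>

lemma monomial_ideal_invariant_diagonal:
  fixes A :: "'k::idom ^ 3 ^ 3"
  assumes "\<And>i j. i \<noteq> j \<Longrightarrow> A $ i $ j = 0"
  shows "monomial_ideal (invariant_ideal d A)"
  unfolding invariant_ideal_def
  by (rule monomial_ideal_ideal_gen)
     (simp add: mat_act_diagonal_fixed_iff[OF assms] form_def keys_monomial)

lemma diag_mat_off_diagonal: "i \<noteq> j \<Longrightarrow> diag_mat e a b c $ i $ j = 0"
  using exhaust_3[of i] exhaust_3[of j] by (auto simp: diag_mat_def)

theorem theorem3p1:
  fixes d :: nat
  assumes "d \<ge> 3"
  shows "(\<forall>(e :: 'k::{alg_closed_field, field_char_0}) (a :: nat) (b :: nat) (c :: nat).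
            primitive_root d e \<and> a \<le> b \<and> b \<le> c \<and> c \<le> d - 1 \<and> Gcd {a, b, c, d} = 1 \<longrightarrow>
            monomial_ideal (invariant_ideal d (diag_mat e a b c)))
       \<and> (\<forall>I :: 'k poly3 set. GT_system d I \<longrightarrow> monomial_ideal I)"
  \<comment> \<open>A GT-system is by definition an \<open>invariant_ideal\<close> of some
    \<open>diag_mat\<close>, so both claims are the same instance.\<close>
  using monomial_ideal_invariant_diagonal[OF diag_mat_off_diagonal]
  unfolding GT_system_def by blast

end
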